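(* Let $X$ be a real Banach space. If $X^*$ is fully Mackey complete, then $X$ is $w^*$-sequentially dense in $X^{**}$, i.e. every element of $X^{**}$ is the $w^*$-limit of a sequence in $X$.
   Context: For a Banach space $Z$, a linear subspace $Y\subset Z^*$ is norming if $|||z|||=\sup\{z^*(z): z^*\in Y,\ \|z^*\|\le 1\}$ defines an equivalent norm on $Z$. $Z$ is fully Mackey complete if $(Z,\mu(Z,Y))$ is complete for every norming and norm-closed subspace $Y\subset Z^*$, where $\mu(Z,Y)$ is the locally convex topology on $Z$ of uniform convergence on absolutely convex $w^*$-compact subsets of $Y$. Here this is applied with $Z=X^*$. *)

theory Defs
  imports "HOL-Analysis.Analysis"
begin

definition weak_star_topology :: "('z::real_normed_vector \<Rightarrow>\<^sub>L real) topology" where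
  "weak_star_topology =
     topology_generated_by {{y. blinfun_apply y z \<in> U} | z U. open (U :: real set)}"

text \<open>Y \<subseteq> Z* is norming: the functional |||z||| = sup of y(z) over the unit ball of Y
  defines an equivalent norm on Z (the bound |||z||| \<le> ||z|| is automatic).\<close>
definition norming :: "('z::real_normed_vector \<Rightarrow>\<^sub>L real) set \<Rightarrow> bool" where
  "norming Y \<longleftrightarrow> (\<exists>c>0. \<forall>z. c * norm z \<le> Sup {blinfun_apply y z | y. y \<in> Y \<and> norm y \<le> 1})"

definition absolutely_convex :: "'v::real_vector set \<Rightarrow> bool" where
  "absolutely_convex K \<longleftrightarrow> convex K \<and> (\<forall>y\<in>K. \<forall>a::real. \<bar>a\<bar> \<le> 1 \<longrightarrow> a *\<^sub>R y \<in> K)"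

definition mackey_sets :: "('z::real_normed_vector \<Rightarrow>\<^sub>L real) set \<Rightarrow> ('z \<Rightarrow>\<^sub>L real) set set" where
  "mackey_sets Y = {K. K \<subseteq> Y \<and> absolutely_convex K \<and> compactin weak_star_topology K}"

definition mackey_cauchy :: "('z::real_normed_vector \<Rightarrow>\<^sub>L real) set \<Rightarrow> 'z filter \<Rightarrow> bool" where
  "mackey_cauchy Y F \<longleftrightarrow> (\<forall>K\<in>mackey_sets Y. \<forall>e>0.
      \<forall>\<^sub>F (a, b) in F \<times>\<^sub>F F. \<forall>y\<in>K. \<bar>blinfun_apply y a - blinfun_apply y b\<bar> \<le> e)"

definition mackey_converges :: "('z::real_normed_vector \<Rightarrow>\<^sub>L real) set \<Rightarrow> 'z filter \<Rightarrow> 'z \<Rightarrow> bool" where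
  "mackey_converges Y F z \<longleftrightarrow> (\<forall>K\<in>mackey_sets Y. \<forall>e>0.
      \<forall>\<^sub>F a in F. \<forall>y\<in>K. \<bar>blinfun_apply y a - blinfun_apply y z\<bar> \<le> e)"

definition mackey_complete :: "('z::real_normed_vector \<Rightarrow>\<^sub>L real) set \<Rightarrow> bool" where
  "mackey_complete Y \<longleftrightarrow> (\<forall>F. F \<noteq> bot \<and> mackey_cauchy Y F \<longrightarrow> (\<exists>z. mackey_converges Y F z))"

definition fully_mackey_complete :: "'z::real_normed_vector itself \<Rightarrow> bool" where
  "fully_mackey_complete _ \<longleftrightarrow>
     (\<forall>Y :: ('z \<Rightarrow>\<^sub>L real) set. subspace Y \<and> closed Y \<and> norming Y \<longrightarrow> mackey_complete Y)"

end

theory Submission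
  imports Defs
begin

text \<open>
  Suppose \<open>\<phi> \<in> X**\<close> is not in \<open>X\<close>, and let \<open>E = X \<oplus> \<real>\<phi>\<close>, a norming closed subspace of \<open>X**\<close>.
  The functional \<open>h\<close> on \<open>E\<close> with \<open>h = 0\<close> on \<open>X\<close> and \<open>h \<phi> = 1\<close> is not evaluation at an element of \<open>X*\<close>.
  Mackey completeness of \<open>(X*, E)\<close> and Grothendieck's completeness theorem therefore
  give an absolutely convex \<open>w*\<close>-compact \<open>K \<subseteq> E\<close> on which \<open>h\<close> is not \<open>w*\<close>-continuous at \<open>0\<close>; after scaling,
  \<open>0\<close> lies in the \<open>w*\<close>-closure of \<open>{k \<in> K. h k = e}\<close> for some \<open>e > 0\<close>.

  Whitley's construction from the Eberlein--Smulian theorem yields \<open>k n = x n + e \<phi>\<close> in that set which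
  tends to \<open>0\<close> on a family of functionals separating the points of the closed span of \<open>\<phi>\<close> and all \<open>k n\<close>.
  A combination of \<open>w*\<close>-cluster points that falls into \<open>X\<close> (up to a multiple of \<open>\<phi>\<close>) lies in that closed span
  by Hahn--Banach. As \<open>E / X\<close> is one-dimensional, this forces the cluster point \<open>u\<close> to be unique and
  \<open>h u \<noteq> e\<close>, so \<open>x n\<close> is \<open>w*\<close>-convergent to an element of \<open>X + c \<phi>\<close> with \<open>c \<noteq> 0\<close>.
\<close>

section \<open>Sublinear functionals and the Hahn--Banach theorem\<close>

definition sublinear :: "('v::real_vector \<Rightarrow> real) \<Rightarrow> bool" where
  "sublinear P \<longleftrightarrow> (\<forall>x y. P (x + y) \<le> P x + P y) \<and> (\<forall>c\<ge>0. \<forall>x. P (c *\<^sub>R x) = c * P x)"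

text \<open>Applying \<open>le\<close> to \<open>inverse c\<close> and \<open>c *\<^sub>R x\<close>
  gives the reverse inequality, so one direction for positive scalars suffices.\<close>

lemma sublinearI:
  assumes "\<And>x y. P (x + y) \<le> P x + P y" "P 0 = 0"
    and le: "\<And>c x. c > 0 \<Longrightarrow> P (c *\<^sub>R x) \<le> c * P x"
  shows "sublinear P"
proof -
  have "P (c *\<^sub>R x) = c * P x" if c: "c \<ge> 0" for c x
  proof (cases "c = 0")
    case False
    with c have "c > 0" by simp
    have "P x = P (inverse c *\<^sub>R (c *\<^sub>R x))" using \<open>c > 0\<close> by simp
    also have "\<dots> \<le> inverse c * P (c *\<^sub>R x)" using le[of "inverse c" "c *\<^sub>R x"] \<open>c > 0\<close> by simp
    finally have "c * P x \<le> P (c *\<^sub>R x)" using \<open>c > 0\<close> by (simp add: field_simps)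
    with le[OF \<open>c > 0\<close>, of x] show ?thesis by simp
  qed (use assms in simp)
  with assms(1) show ?thesis by (auto simp: sublinear_def)
qed

lemma
  assumes "sublinear P"
  shows sublinear_add: "P (x + y) \<le> P x + P y"
    and sublinear_scale: "c \<ge> 0 \<Longrightarrow> P (c *\<^sub>R x) = c * P x"
    and sublinear_zero: "P 0 = 0"
    and sublinear_minus: "- P (- x) \<le> P x"
proof -
  show add: "P (x + y) \<le> P x + P y" for x y using assms by (simp add: sublinear_def)
  show scale: "c \<ge> 0 \<Longrightarrow> P (c *\<^sub>R x) = c * P x" for c x using assms by (simp add: sublinear_def)
  show zero: "P 0 = 0" using scale[of 0 0] by simp
  show "- P (- x) \<le> P x" using add[of x "- x"] zero by simp
qed

text \<open>
  The largest sublinear functional below \<open>P\<close> whose value at \<open>- k\<close> is at most \<open>- g k\<close> for \<open>k \<in> K\<close>.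
  For \<open>K = {x}\<close> and \<open>g = P\<close> it shows that minimal sublinear functionals are odd, hence linear.
\<close>
definition lowered :: "('v::real_vector \<Rightarrow> real) \<Rightarrow> 'v set \<Rightarrow> ('v \<Rightarrow> real) \<Rightarrow> 'v \<Rightarrow> real" where
  "lowered P K g y = Inf {P (y + t *\<^sub>R k) - t * g k | t k. 0 \<le> t \<and> k \<in> K}"

context
  fixes P :: "'v::real_vector \<Rightarrow> real" and K g
  assumes P: "sublinear P" and ne: "K \<noteq> {}" and conc: "concave_on K g"
    and gP: "\<And>k. k \<in> K \<Longrightarrow> g k \<le> P k"
begin

text \<open>This bound, uniform in t and k, makes the \<open>Inf\<close> in \<open>lowered\<close> a
  genuine infimum. It rests on g \<le> P over K.\<close>

lemma lowered_below:
  assumes "0 \<le> t" "k \<in> K"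
  shows "- P (- y) \<le> P (y + t *\<^sub>R k) - t * g k"
proof -
  have "t * g k \<le> t * P k" using gP assms by (simp add: mult_left_mono)
  also have "\<dots> = P (t *\<^sub>R k)" using P assms by (simp add: sublinear_scale)
  also have "\<dots> \<le> P (y + t *\<^sub>R k) + P (- y)"
    using sublinear_add[OF P, of "y + t *\<^sub>R k" "- y"] by simp
  finally show ?thesis by simp
qed

lemma lowered_le:
  assumes "0 \<le> t" "k \<in> K"
  shows "lowered P K g y \<le> P (y + t *\<^sub>R k) - t * g k"
  unfolding lowered_def
proof (rule cInf_lower)
  show "bdd_below {P (y + t *\<^sub>R k) - t * g k | t k. 0 \<le> t \<and> k \<in> K}"
    by (rule bdd_belowI[where m = "- P (- y)"]) (auto intro: lowered_below)
qed (use assms in auto)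

lemma lowered_greatest:
  assumes "\<And>t k. 0 \<le> t \<Longrightarrow> k \<in> K \<Longrightarrow> c \<le> P (y + t *\<^sub>R k) - t * g k"
  shows "c \<le> lowered P K g y"
  unfolding lowered_def
proof (rule cInf_greatest)
  obtain k where "k \<in> K" using ne by blast
  then have "P (y + 0 *\<^sub>R k) - 0 * g k \<in> {P (y + t *\<^sub>R k) - t * g k | t k. 0 \<le> t \<and> k \<in> K}"
    by blast
  then show "{P (y + t *\<^sub>R k) - t * g k | t k. 0 \<le> t \<and> k \<in> K} \<noteq> {}" by blast
qed (use assms in auto)

lemma lowered_le_self: "lowered P K g y \<le> P y"
proof -
  obtain k where "k \<in> K" using ne by blast
  from lowered_le[OF order_refl this] show ?thesis by simp
qed

lemma lowered_minus_le: "k \<in> K \<Longrightarrow> lowered P K g (- k) \<le> - g k"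
  using lowered_le[of 1 k "- k"] sublinear_zero[OF P] by simp

text \<open>Subadditivity is where concavity enters: the shifts s k and t l merge into one shift (s
  + t) m, with m a convex combination of k and l, and concavity gives s g(k) + t g(l) \<le> (s + t)
  g(m).\<close>

lemma sublinear_lowered: "sublinear (lowered P K g)"
proof (rule sublinearI)
  fix x y
  have *: "lowered P K g (x + y) \<le> (P (x + s *\<^sub>R k) - s * g k) + (P (y + t *\<^sub>R l) - t * g l)"
    if st: "0 \<le> s" "0 \<le> t" and kl: "k \<in> K" "l \<in> K" for s t k l
  proof (cases "s + t = 0")
    case True
    with st have "s = 0" "t = 0" by auto
    with lowered_le_self[of "x + y"] sublinear_add[OF P, of x y] show ?thesis by simp
  next
    case False
    define r where "r = s + t"
    define m where "m = (s / r) *\<^sub>R k + (t / r) *\<^sub>R l"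
    have r: "r > 0" using False st by (simp add: r_def)
    have one: "s / r + t / r = 1" using r by (simp add: r_def flip: add_divide_distrib)
    have K: "convex K" using conc by (simp add: concave_on_iff)
    have m: "m \<in> K" unfolding m_def using K kl st r one by (intro convexD) auto
    have "(s / r) * g k + (t / r) * g l \<le> g m"
      using conc[unfolded concave_on_iff, THEN conjunct2, rule_format, OF kl, of "s / r" "t / r"] st r one
      by (simp add: m_def)
    then have gm: "s * g k + t * g l \<le> r * g m" using r by (simp add: field_simps)
    have rm: "r *\<^sub>R m = s *\<^sub>R k + t *\<^sub>R l" using r by (simp add: m_def scaleR_add_right)
    have "lowered P K g (x + y) \<le> P (x + y + r *\<^sub>R m) - r * g m"
      using r m by (intro lowered_le) auto
    also have "x + y + r *\<^sub>R m = (x + s *\<^sub>R k) + (y + t *\<^sub>R l)" using rm by (simp add: algebra_simps)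
    also have "P \<dots> - r * g m \<le> P (x + s *\<^sub>R k) + P (y + t *\<^sub>R l) - (s * g k + t * g l)"
      using sublinear_add[OF P, of "x + s *\<^sub>R k" "y + t *\<^sub>R l"] gm by linarith
    finally show ?thesis by simp
  qed
  have "lowered P K g (x + y) - lowered P K g x \<le> lowered P K g y"
  proof (rule lowered_greatest)
    fix t :: real and l assume tl: "0 \<le> t" "l \<in> K"
    have "lowered P K g (x + y) - (P (y + t *\<^sub>R l) - t * g l) \<le> lowered P K g x"
    proof (rule lowered_greatest)
      fix s :: real and k assume "0 \<le> s" "k \<in> K"
      from *[OF this(1) tl(1) this(2) tl(2)]
      show "lowered P K g (x + y) - (P (y + t *\<^sub>R l) - t * g l) \<le> P (x + s *\<^sub>R k) - s * g k"
        by simp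
    qed
    then show "lowered P K g (x + y) - lowered P K g x \<le> P (y + t *\<^sub>R l) - t * g l" by simp
  qed
  then show "lowered P K g (x + y) \<le> lowered P K g x + lowered P K g y" by simp
next
  have "0 \<le> lowered P K g 0"
    by (rule lowered_greatest) (use lowered_below[of _ _ 0] sublinear_zero[OF P] in auto)
  with lowered_le_self[of 0] sublinear_zero[OF P] show "lowered P K g 0 = 0" by simp
next
  fix c :: real and x assume c: "c > 0"
  have "lowered P K g (c *\<^sub>R x) / c \<le> lowered P K g x"
  proof (rule lowered_greatest)
    fix t :: real and k assume tk: "0 \<le> t" "k \<in> K"
    have "lowered P K g (c *\<^sub>R x) \<le> P (c *\<^sub>R x + (c * t) *\<^sub>R k) - (c * t) * g k"
      using tk c by (intro lowered_le) auto
    also have "c *\<^sub>R x + (c * t) *\<^sub>R k = c *\<^sub>R (x + t *\<^sub>R k)" by (simp add: scaleR_add_right)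
    also have "P \<dots> = c * P (x + t *\<^sub>R k)" using c by (intro sublinear_scale[OF P]) auto
    finally show "lowered P K g (c *\<^sub>R x) / c \<le> P (x + t *\<^sub>R k) - t * g k"
      using c by (simp add: field_simps)
  qed
  then show "lowered P K g (c *\<^sub>R x) \<le> c * lowered P K g x" using c by (simp add: field_simps)
qed

end

text \<open>Every p in C satisfies - P(-x) \<le> p(x), so the infimum is finite. For subadditivity,
  p(x) + q(y) is at least r(x) + r(y) with r the smaller of p and q, which exists in a
  chain.\<close>

lemma sublinear_chain_Inf:
  assumes C: "C \<noteq> {}" "\<And>p. p \<in> C \<Longrightarrow> sublinear p" "\<And>p. p \<in> C \<Longrightarrow> p \<le> P"
    and chain: "\<And>p q. p \<in> C \<Longrightarrow> q \<in> C \<Longrightarrow> p \<le> q \<or> q \<le> p"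
  defines "u \<equiv> \<lambda>x. INF p\<in>C. p x"
  shows "sublinear u" "p \<in> C \<Longrightarrow> u \<le> p"
proof -
  have bdd: "bdd_below ((\<lambda>p. p x) ` C)" for x
  proof (rule bdd_belowI2)
    fix p assume p: "p \<in> C"
    have "- P (- x) \<le> - p (- x)" using C(3)[OF p] by (simp add: le_fun_def)
    with sublinear_minus[OF C(2)[OF p], of x] show "- P (- x) \<le> p x" by linarith
  qed
  have low: "u x \<le> p x" if "p \<in> C" for p x
    unfolding u_def using bdd that by (rule cINF_lower)
  then show "p \<in> C \<Longrightarrow> u \<le> p" by (simp add: le_fun_def)
  have grt: "c \<le> u x" if "\<And>p. p \<in> C \<Longrightarrow> c \<le> p x" for c x
    unfolding u_def using C(1) that by (rule cINF_greatest)
  show "sublinear u"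
  proof (rule sublinearI)
    fix x y
    have *: "u (x + y) \<le> p x + q y" if pq: "p \<in> C" "q \<in> C" for p q
    proof -
      obtain r where "r \<in> C" "r \<le> p" "r \<le> q" using chain[OF pq] pq by blast
      then have "r x \<le> p x" "r y \<le> q y" by (auto simp: le_fun_def)
      with low[OF \<open>r \<in> C\<close>, of "x + y"] sublinear_add[OF C(2)[OF \<open>r \<in> C\<close>], of x y] show ?thesis
        by linarith
    qed
    have "u (x + y) - u x \<le> u y"
    proof (rule grt)
      fix q assume q: "q \<in> C"
      have "u (x + y) - q y \<le> u x" by (rule grt) (use *[OF _ q] in \<open>simp add: algebra_simps\<close>)
      then show "u (x + y) - u x \<le> q y" by simp
    qed
    then show "u (x + y) \<le> u x + u y" by simp
  next
    have "p 0 = 0" if "p \<in> C" for p using C(2)[OF that] by (rule sublinear_zero)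
    then have "(\<lambda>p. p 0) ` C = {0}" using C(1) by force
    then show "u 0 = 0" by (simp add: u_def)
  next
    fix c :: real and x assume c: "c > 0"
    have "u (c *\<^sub>R x) / c \<le> u x"
    proof (rule grt)
      fix p assume p: "p \<in> C"
      show "u (c *\<^sub>R x) / c \<le> p x"
        using low[OF p, of "c *\<^sub>R x"] sublinear_scale[OF C(2)[OF p], of c x] c by (simp add: field_simps)
    qed
    then show "u (c *\<^sub>R x) \<le> c * u x" using c by (simp add: field_simps)
  qed
qed

text \<open>Zorn's lemma, for the reversed order, gives a minimal sublinear functional f below P.
  Lowering f along a single vector cannot change it, so f is odd, and an odd sublinear functional is
  linear.\<close>

lemma hahn_banach_sublinear:
  fixes P :: "'v::real_vector \<Rightarrow> real"
  assumes P: "sublinear P"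
  obtains f where "linear f" "\<And>x. f x \<le> P x"
proof -
  define A where "A = {p. sublinear p \<and> p \<le> P}"
  define R where "R = relation_of (\<lambda>p q :: 'v \<Rightarrow> real. q \<le> p) A"
  have po: "partial_order_on A R"
    unfolding R_def by (rule partial_order_on_relation_ofI) auto
  have "\<exists>m\<in>A. \<forall>a\<in>A. a \<le> m \<longrightarrow> a = m"
  proof (rule predicate_Zorn[OF po[unfolded R_def]])
    fix C assume "C \<in> Chains (relation_of (\<lambda>p q. q \<le> p) A)"
    then have C: "C \<subseteq> A" "\<And>p q. p \<in> C \<Longrightarrow> q \<in> C \<Longrightarrow> p \<le> q \<or> q \<le> p"
      by (auto simp: Chains_def relation_of_def)
    show "\<exists>u\<in>A. \<forall>a\<in>C. u \<le> a"
    proof (cases "C = {}")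
      case True
      with P show ?thesis by (auto simp: A_def)
    next
      case False
      have "sublinear (\<lambda>x. INF p\<in>C. p x)" and le: "p \<in> C \<Longrightarrow> (\<lambda>x. INF p\<in>C. p x) \<le> p" for p
        using sublinear_chain_Inf[of C P, OF False _ _ C(2)] C(1) by (auto simp: A_def)
      moreover have "(\<lambda>x. INF p\<in>C. p x) \<le> P"
      proof -
        obtain p where "p \<in> C" using False by blast
        with le[of p] C(1) show ?thesis by (auto simp: A_def intro: order_trans)
      qed
      ultimately show ?thesis by (intro bexI[where x = "\<lambda>x. INF p\<in>C. p x"]) (auto simp: A_def)
    qed
  qed
  then obtain f where f: "sublinear f" "f \<le> P" and min: "\<And>p. sublinear p \<Longrightarrow> p \<le> f \<Longrightarrow> p = f"
    unfolding A_def by (auto intro: order_trans)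
  have odd: "f (- x) = - f x" for x
  proof -
    have c: "concave_on {x} f" by (auto simp: concave_on_iff simp flip: scaleR_add_left distrib_right)
    have "lowered f {x} f = f"
      using f(1) c by (intro min sublinear_lowered) (auto simp: le_fun_def intro: lowered_le_self)
    with lowered_minus_le[of f "{x}" f x] f(1) c have "f (- x) \<le> - f x" by simp
    with sublinear_minus[OF f(1), of x] show ?thesis by linarith
  qed
  have "linear f"
  proof (rule linearI)
    show "f (x + y) = f x + f y" for x y
      using sublinear_add[OF f(1), of x y] sublinear_add[OF f(1), of "- x" "- y"] odd[of "x + y"] odd
      by simp
    show "f (c *\<^sub>R x) = c *\<^sub>R f x" for c x
      using sublinear_scale[OF f(1), of c x] sublinear_scale[OF f(1), of "- c" x] odd[of "c *\<^sub>R x"]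
      by (cases "c \<ge> 0") auto
  qed
  with f(2) show thesis by (intro that[of f]) (auto simp: le_fun_def)
qed

text \<open>Hahn--Banach is applied to \<open>lowered P K g\<close>: its bound at -k becomes, by
  oddness of f, the lower bound at k.\<close>

lemma mazur_orlicz:
  fixes P :: "'v::real_vector \<Rightarrow> real"
  assumes "sublinear P" "K \<noteq> {}" "concave_on K g" "\<And>k. k \<in> K \<Longrightarrow> g k \<le> P k"
  obtains f where "linear f" "\<And>x. f x \<le> P x" "\<And>k. k \<in> K \<Longrightarrow> g k \<le> f k"
proof -
  obtain f where f: "linear f" "\<And>x. f x \<le> lowered P K g x"
    using hahn_banach_sublinear[OF sublinear_lowered[OF assms]] by metis
  show thesis
  proof (rule that[OF f(1)])
    show "f x \<le> P x" for x using f(2) lowered_le_self[OF assms] order_trans by blast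
    show "g k \<le> f k" if "k \<in> K" for k
      using f(2)[of "- k"] lowered_minus_le[OF assms that] linear_neg[OF f(1), of k] by linarith
  qed
qed

section \<open>Bounded functionals obtained from sublinear ones\<close>

lemma sublinear_norm: "sublinear (norm :: 'v::real_normed_vector \<Rightarrow> real)"
  by (rule sublinearI) (auto simp: norm_triangle_ineq)

text \<open>The distance to S is the quotient seminorm modulo S; approximating points of S may be
  added and scaled within S.\<close>

lemma sublinear_infdist:
  fixes S :: "'v::real_normed_vector set"
  assumes S: "subspace S"
  shows "sublinear (\<lambda>x. infdist x S)"
proof (rule sublinearI)
  have ne: "S \<noteq> {}" using subspace_0[OF S] by blast
  have low: "infdist x S \<le> dist x s" if "s \<in> S" for x s using that by (rule infdist_le)
  have grt: "c \<le> infdist x S" if "\<And>s. s \<in> S \<Longrightarrow> c \<le> dist x s" for c x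
    unfolding infdist_notempty[OF ne] using ne that by (rule cINF_greatest)
  show "infdist (x + y) S \<le> infdist x S + infdist y S" for x y
  proof -
    have "infdist (x + y) S - infdist x S \<le> infdist y S"
    proof (rule grt)
      fix t assume t: "t \<in> S"
      have "infdist (x + y) S - dist y t \<le> infdist x S"
      proof (rule grt)
        fix s assume s: "s \<in> S"
        have "infdist (x + y) S \<le> dist (x + y) (s + t)" using S s t by (intro low subspace_add)
        also have "\<dots> \<le> dist x s + dist y t" by (rule dist_triangle_add)
        finally show "infdist (x + y) S - dist y t \<le> dist x s" by simp
      qed
      then show "infdist (x + y) S - infdist x S \<le> dist y t" by simp
    qed
    then show ?thesis by simp
  qed
  show "infdist 0 S = 0" using subspace_0[OF S] by simp
  show "infdist (c *\<^sub>R x) S \<le> c * infdist x S" if c: "c > 0" for c x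
  proof -
    have "infdist (c *\<^sub>R x) S / c \<le> infdist x S"
    proof (rule grt)
      fix s assume s: "s \<in> S"
      have "infdist (c *\<^sub>R x) S \<le> dist (c *\<^sub>R x) (c *\<^sub>R s)" using S s by (intro low subspace_scale)
      also have "\<dots> = c * dist x s" using c by (simp add: dist_norm flip: scaleR_diff_right)
      finally show "infdist (c *\<^sub>R x) S / c \<le> dist x s" using c by (simp add: field_simps)
    qed
    then show ?thesis using c by (simp add: field_simps)
  qed
qed

text \<open>Mazur--Orlicz for the singleton of x with g = P. Domination by the norm makes the linear
  functional bounded.\<close>

lemma hahn_banach_pointed:
  fixes P :: "'v::real_normed_vector \<Rightarrow> real"
  assumes P: "sublinear P" "\<And>y. P y \<le> norm y"
  obtains f :: "'v \<Rightarrow>\<^sub>L real" where "\<And>y. blinfun_apply f y \<le> P y" "blinfun_apply f x = P x"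
proof -
  have "concave_on {x} P" by (auto simp: concave_on_iff simp flip: scaleR_add_left distrib_right)
  then obtain f where f: "linear f" "\<And>y. f y \<le> P y" "P x \<le> f x"
    using mazur_orlicz[OF P(1), of "{x}" P] by auto
  have "\<bar>f y\<bar> \<le> norm y * 1" for y
    using order_trans[OF f(2) P(2), of y] order_trans[OF f(2) P(2), of "- y"] linear_neg[OF f(1), of y]
    by (simp add: abs_le_iff)
  then have "bounded_linear f"
    using f(1) by (intro bounded_linear_intro[of f 1]) (auto simp: linear_add linear_scale)
  then have "blinfun_apply (Blinfun f) = f" by (rule bounded_linear_Blinfun_apply)
  with f show thesis by (intro that[of "Blinfun f"]) (auto intro: antisym)
qed

text \<open>A functional dominated by the distance to S vanishes on S, since both s and -s have
  distance 0. Closedness makes the distance of x positive, so one may divide by it.\<close>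

lemma hahn_banach_closed_subspace:
  fixes x :: "'v::real_normed_vector"
  assumes S: "subspace S" "closed S" and x: "x \<notin> S"
  obtains f :: "'v \<Rightarrow>\<^sub>L real" where "\<And>s. s \<in> S \<Longrightarrow> blinfun_apply f s = 0" "blinfun_apply f x = 1"
proof -
  have 0: "0 \<in> S" using S(1) by (rule subspace_0)
  have le: "infdist y S \<le> norm y" for y using infdist_le[OF 0, of y] by simp
  obtain f :: "'v \<Rightarrow>\<^sub>L real" where f: "\<And>y. blinfun_apply f y \<le> infdist y S" "blinfun_apply f x = infdist x S"
    using hahn_banach_pointed[OF sublinear_infdist[OF S(1)] le, of x] by metis
  have d: "infdist x S \<noteq> 0" using in_closed_iff_infdist_zero[OF S(2)] 0 x by blast
  have "blinfun_apply f s = 0" if "s \<in> S" for s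
    using f(1)[of s] f(1)[of "- s"] that subspace_neg[OF S(1) that] by (simp add: blinfun.minus_right)
  with f(2) d show thesis
    by (intro that[of "inverse (infdist x S) *\<^sub>R f"]) (auto simp: blinfun.scaleR_left)
qed

section \<open>The canonical embedding into the bidual\<close>

definition ev :: "'a::real_normed_vector \<Rightarrow> ('a \<Rightarrow>\<^sub>L real) \<Rightarrow>\<^sub>L real" where
  "ev x = Blinfun (\<lambda>f. blinfun_apply f x)"

lemma ev_apply [simp]: "blinfun_apply (ev x) f = blinfun_apply f x"
  by (simp add: ev_def bounded_linear_Blinfun_apply blinfun.bounded_linear_left)

text \<open>The lower bound tests \<open>ev x\<close> on a functional of norm at most 1 that takes
  the value \<open>norm x\<close> at x.\<close>

lemma norm_ev [simp]: "norm (ev x) = norm x"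
proof (rule antisym)
  show "norm (ev x) \<le> norm x"
  proof (rule norm_blinfun_bound)
    show "norm (blinfun_apply (ev x) f) \<le> norm x * norm f" for f
      using norm_blinfun[of f x] by (simp add: mult.commute)
  qed simp
  obtain f :: "'a \<Rightarrow>\<^sub>L real" where f: "\<And>y. blinfun_apply f y \<le> norm y" "blinfun_apply f x = norm x"
    using hahn_banach_pointed[OF sublinear_norm, of x] by auto
  have "norm f \<le> 1"
    using f(1) f(1)[of "- _"] by (intro norm_blinfun_bound) (auto simp: abs_le_iff blinfun.minus_right)
  have "norm x = blinfun_apply (ev x) f" using f(2) by simp
  also have "\<dots> \<le> norm (ev x) * norm f" using norm_blinfun[of "ev x" f] by simp
  also have "\<dots> \<le> norm (ev x)" using \<open>norm f \<le> 1\<close> by (simp add: mult_left_le)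
  finally show "norm x \<le> norm (ev x)" .
qed

lemma linear_ev: "linear ev"
  by (rule linearI) (auto intro!: blinfun_eqI simp: blinfun.bilinear_simps)

lemma bounded_linear_ev: "bounded_linear ev"
  by (rule bounded_linear_intro[of ev 1])
    (simp_all add: linear_add[OF linear_ev] linear_scale[OF linear_ev])

text \<open>The isometric image of a complete space is complete. This is where completeness of X
  enters.\<close>

lemma closed_range_ev: "closed (range (ev :: 'a::banach \<Rightarrow> _))"
proof -
  have "complete (range (ev :: 'a \<Rightarrow> _))"
    by (rule complete_isometric_image[of 1]) (auto simp: bounded_linear_ev complete_UNIV)
  then show ?thesis by (rule complete_imp_closed)
qed

lemma subspace_range_ev: "subspace (range ev)"
  using linear_subspace_image[OF linear_ev subspace_UNIV] .

section \<open>The weak-star topology\<close>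

lemma linear_functional_in_span:
  fixes v :: "('z::real_normed_vector \<Rightarrow>\<^sub>L real) \<Rightarrow> real"
  assumes "finite F" "linear v" "\<And>y. (\<And>f. f \<in> F \<Longrightarrow> blinfun_apply y f = 0) \<Longrightarrow> v y = 0"
  obtains z where "\<And>y. v y = blinfun_apply y z"
proof -
  have "\<exists>z. \<forall>y. v y = blinfun_apply y z"
    using assms
  proof (induction F arbitrary: v rule: finite_induct)
    case empty
    then have "v y = blinfun_apply y 0" for y by (simp add: blinfun.zero_right)
    then show ?case by blast
  next
    case (insert g F)
    show ?case
    proof (cases "\<forall>y :: 'z \<Rightarrow>\<^sub>L real. (\<forall>f\<in>F. blinfun_apply y f = 0) \<longrightarrow> blinfun_apply y g = 0")
      case True
      show ?thesis
      proof (rule insert.IH[OF insert.prems(1)])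
        fix y :: "'z \<Rightarrow>\<^sub>L real" assume y: "\<And>f. f \<in> F \<Longrightarrow> blinfun_apply y f = 0"
        with True have "blinfun_apply y g = 0" by blast
        with y show "v y = 0" by (intro insert.prems(2)) auto
      qed
    next
      case False
      then obtain y0 :: "'z \<Rightarrow>\<^sub>L real" where y0: "\<And>f. f \<in> F \<Longrightarrow> blinfun_apply y0 f = 0" "blinfun_apply y0 g \<noteq> 0" by auto
      define c where "c = v y0 / blinfun_apply y0 g"
      have "\<exists>z. \<forall>y. v y - c * blinfun_apply y g = blinfun_apply y z"
      proof (rule insert.IH)
        show "linear (\<lambda>y. v y - c * blinfun_apply y g)"
          using insert.prems(1)
          by (intro linearI) (auto simp: linear_add linear_scale blinfun.bilinear_simps algebra_simps)
        fix y :: "'z \<Rightarrow>\<^sub>L real" assume y: "\<And>f. f \<in> F \<Longrightarrow> blinfun_apply y f = 0"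
        define w where "w = y - (blinfun_apply y g / blinfun_apply y0 g) *\<^sub>R y0"
        have "v w = 0"
          by (rule insert.prems(2), erule insertE) (simp_all add: y y0 w_def blinfun.bilinear_simps)
        then show "v y - c * blinfun_apply y g = 0"
          using insert.prems(1) by (simp add: w_def c_def linear_diff linear_scale)
      qed
      then obtain z where "\<And>y. v y - c * blinfun_apply y g = blinfun_apply y z" by blast
      then have "v y = blinfun_apply y (z + c *\<^sub>R g)" for y
        by (simp add: blinfun.bilinear_simps eq_diff_eq flip: diff_eq_eq)
      then show ?thesis by blast
    qed
  qed
  with that show thesis by blast
qed

section \<open>Continuity, basic neighbourhoods and cluster points\<close>

lemma topspace_weak_star [simp]: "topspace weak_star_topology = UNIV"
proof -
  have "UNIV \<in> {{y :: 'a \<Rightarrow>\<^sub>L real. blinfun_apply y z \<in> U} | z U. open U}"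
    by (auto intro!: exI[of _ 0] exI[of _ UNIV])
  then show ?thesis unfolding weak_star_topology_def topology_generated_by_topspace by blast
qed

lemma openin_weak_star_eval: "open U \<Longrightarrow> openin weak_star_topology {y. blinfun_apply y z \<in> U}"
  unfolding weak_star_topology_def by (rule topology_generated_by_Basis) auto

lemma continuous_map_weak_star_eval:
  "continuous_map weak_star_topology euclideanreal (\<lambda>y. blinfun_apply y z)"
  by (auto simp: continuous_map_def intro: openin_weak_star_eval)

lemma continuous_map_into_weak_star:
  fixes f :: "'a \<Rightarrow> 'b::real_normed_vector \<Rightarrow>\<^sub>L real"
  assumes "\<And>z. continuous_map T euclideanreal (\<lambda>x. blinfun_apply (f x) z)"
  shows "continuous_map T weak_star_topology f"
  unfolding weak_star_topology_def continuous_on_generated_topo_iff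
proof (intro conjI allI impI)
  fix V assume "V \<in> {{y :: 'b \<Rightarrow>\<^sub>L real. blinfun_apply y z \<in> U} | z U. open (U :: real set)}"
  then obtain z U where V: "V = {y. blinfun_apply y z \<in> U}" "open U" by blast
  have "openin T {x \<in> topspace T. blinfun_apply (f x) z \<in> U}"
    using assms[of z] V(2) by (auto simp: continuous_map_def)
  also have "{x \<in> topspace T. blinfun_apply (f x) z \<in> U} = f -` V \<inter> topspace T" using V(1) by auto
  finally show "openin T (f -` V \<inter> topspace T)" .
next
  show "f ` topspace T \<subseteq> \<Union> {{y :: 'b \<Rightarrow>\<^sub>L real. blinfun_apply y z \<in> U} | z U. open (U :: real set)}"
    using topspace_weak_star[where 'a = 'b] unfolding weak_star_topology_def topology_generated_by_topspace
    by simp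
qed

lemma openin_weak_star_basic:
  assumes "finite F"
  shows "openin weak_star_topology {y. \<forall>f\<in>F. \<bar>blinfun_apply y f - blinfun_apply q f\<bar> < d}"
proof -
  have "openin weak_star_topology {y. \<bar>blinfun_apply y f - blinfun_apply q f\<bar> < d}" for f :: 'a
    using openin_weak_star_eval[of "ball (blinfun_apply q f) d" f] by (simp add: dist_real_def abs_minus_commute)
  then have "openin weak_star_topology (topspace weak_star_topology \<inter>
      (\<Inter>f\<in>F. {y. \<bar>blinfun_apply y f - blinfun_apply q f\<bar> < d}))"
    by (intro openin_Int_Inter assms finite_imageI openin_topspace) auto
  also have "topspace weak_star_topology \<inter> (\<Inter>f\<in>F. {y. \<bar>blinfun_apply y f - blinfun_apply q f\<bar> < d}) =
      {y. \<forall>f\<in>F. \<bar>blinfun_apply y f - blinfun_apply q f\<bar> < d}" by auto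
  finally show ?thesis .
qed

text \<open>The index set N stands for a subsequence, so that clustering along a subsequence can be
  compared with clustering of the whole sequence without reindexing.\<close>

definition weak_star_cluster :: "(nat \<Rightarrow> 'z::real_normed_vector \<Rightarrow>\<^sub>L real) \<Rightarrow> nat set \<Rightarrow> ('z \<Rightarrow>\<^sub>L real) \<Rightarrow> bool" where
  "weak_star_cluster k N q \<longleftrightarrow> (\<forall>F d. finite F \<longrightarrow> 0 < d \<longrightarrow>
     infinite {n \<in> N. \<forall>f\<in>F. \<bar>blinfun_apply (k n) f - blinfun_apply q f\<bar> < d})"

text \<open>Otherwise each point of K has a basic neighbourhood visited for only finitely many
  indices in N; finitely many of these cover K, which would make N finite.\<close>

lemma weak_star_cluster_exists:
  assumes K: "compactin weak_star_topology K" and k: "\<And>n. k n \<in> K" and N: "infinite N"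
  shows "\<exists>q\<in>K. weak_star_cluster k N q"
proof (rule ccontr)
  assume none: "\<not> (\<exists>q\<in>K. weak_star_cluster k N q)"
  define R where "R q F d \<longleftrightarrow> finite F \<and> 0 < d \<and>
     finite {n \<in> N. \<forall>f\<in>F. \<bar>blinfun_apply (k n) f - blinfun_apply q f\<bar> < d}" for q F d
  have "\<forall>q\<in>K. \<exists>F d. R q F d" using none unfolding weak_star_cluster_def R_def by blast
  then obtain F d where "\<And>q. q \<in> K \<Longrightarrow> R q (F q) (d q)" by metis
  then have Fd: "finite (F q)" "0 < d q"
      "finite {n \<in> N. \<forall>f\<in>F q. \<bar>blinfun_apply (k n) f - blinfun_apply q f\<bar> < d q}" if "q \<in> K" for q
    using that unfolding R_def by blast+
  define V where "V q = {y. \<forall>f\<in>F q. \<bar>blinfun_apply y f - blinfun_apply q f\<bar> < d q}" for q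
  have "\<exists>\<F>. finite \<F> \<and> \<F> \<subseteq> V ` K \<and> K \<subseteq> \<Union>\<F>"
  proof (rule compactinD[OF K])
    show "openin weak_star_topology U" if "U \<in> V ` K" for U
      using that Fd by (auto simp: V_def intro: openin_weak_star_basic)
    show "K \<subseteq> \<Union> (V ` K)" using Fd by (force simp: V_def)
  qed
  then obtain Q where Q: "finite Q" "Q \<subseteq> K" "K \<subseteq> \<Union> (V ` Q)" by (metis finite_subset_image)
  have "N \<subseteq> (\<Union>q\<in>Q. {n \<in> N. \<forall>f\<in>F q. \<bar>blinfun_apply (k n) f - blinfun_apply q f\<bar> < d q})"
    using Q(3) k unfolding V_def by blast
  moreover have "finite \<dots>" using Q Fd by blast
  ultimately show False using N finite_subset by blast
qed

lemma weak_star_cluster_mono: "weak_star_cluster k N q \<Longrightarrow> N \<subseteq> N' \<Longrightarrow> weak_star_cluster k N' q"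
  unfolding weak_star_cluster_def
proof (intro allI impI)
  fix F :: "'a set" and d :: real
  assume *: "\<forall>F d. finite F \<longrightarrow> 0 < d \<longrightarrow>
      infinite {n \<in> N. \<forall>f\<in>F. \<bar>blinfun_apply (k n) f - blinfun_apply q f\<bar> < d}"
    and "N \<subseteq> N'" "finite F" "0 < d"
  have "infinite {n \<in> N. \<forall>f\<in>F. \<bar>blinfun_apply (k n) f - blinfun_apply q f\<bar> < d}"
    using * \<open>finite F\<close> \<open>0 < d\<close> by blast
  then show "infinite {n \<in> N'. \<forall>f\<in>F. \<bar>blinfun_apply (k n) f - blinfun_apply q f\<bar> < d}"
    by (rule infinite_super[rotated]) (use \<open>N \<subseteq> N'\<close> in blast)
qed

lemma weak_star_cluster_eval:
  assumes "weak_star_cluster k N q" "(\<lambda>n. blinfun_apply (k n) f) \<longlonglongrightarrow> l"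
  shows "blinfun_apply q f = l"
proof (rule ccontr)
  assume "blinfun_apply q f \<noteq> l"
  define d where "d = \<bar>blinfun_apply q f - l\<bar> / 2"
  have d: "d > 0" using \<open>blinfun_apply q f \<noteq> l\<close> by (simp add: d_def)
  obtain m where m: "\<And>n. n \<ge> m \<Longrightarrow> \<bar>blinfun_apply (k n) f - l\<bar> < d"
    using LIMSEQ_D[OF assms(2) d] by auto
  have "infinite {n \<in> N. \<bar>blinfun_apply (k n) f - blinfun_apply q f\<bar> < d}"
    using assms(1) d by (auto simp: weak_star_cluster_def dest!: spec[of _ "{f}"])
  then obtain n where "n \<ge> m" "\<bar>blinfun_apply (k n) f - blinfun_apply q f\<bar> < d"
    unfolding infinite_nat_iff_unbounded_le by blast
  with m[of n] show False unfolding d_def by (auto simp: abs_if split: if_splits)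
qed

text \<open>If convergence fails at f, infinitely many indices stay away from q(f). A cluster point
  along them is one of the whole sequence, hence equals q, which is absurd.\<close>

lemma unique_weak_star_cluster_tendsto:
  assumes K: "compactin weak_star_topology K" "\<And>n. k n \<in> K"
    and uniq: "\<And>q'. q' \<in> K \<Longrightarrow> weak_star_cluster k UNIV q' \<Longrightarrow> q' = q"
  shows "(\<lambda>n. blinfun_apply (k n) f) \<longlonglongrightarrow> blinfun_apply q f"
proof (rule LIMSEQ_I)
  fix r :: real assume r: "0 < r"
  define N where "N = {n. \<not> \<bar>blinfun_apply (k n) f - blinfun_apply q f\<bar> < r}"
  have "finite N"
  proof (rule ccontr)
    assume "infinite N"
    from weak_star_cluster_exists[of K k N, OF K this] obtain q' where q': "q' \<in> K" "weak_star_cluster k N q'" by blast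
    have "q' = q" by (rule uniq[OF q'(1) weak_star_cluster_mono[OF q'(2)]]) simp
    with q'(2) r have "infinite {n \<in> N. \<bar>blinfun_apply (k n) f - blinfun_apply q f\<bar> < r}"
      by (auto simp: weak_star_cluster_def dest!: spec[of _ "{f}"])
    then show False by (auto simp: N_def)
  qed
  then obtain m where "N \<subseteq> {..<m}" unfolding finite_nat_iff_bounded ..
  then show "\<exists>m. \<forall>n\<ge>m. norm (blinfun_apply (k n) f - blinfun_apply q f) < r"
    by (intro exI[of _ m]) (force simp: N_def)
qed

section \<open>Mackey completeness\<close>

text \<open>Sums make the Mackey sets directed: when both summands contain 0, the sum contains each
  of them. Compactness comes from continuity of addition on the product.\<close>

lemma mackey_sets_sum:
  assumes Y: "subspace Y" and "K1 \<in> mackey_sets Y" "K2 \<in> mackey_sets Y"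
  shows "{a + b | a b. a \<in> K1 \<and> b \<in> K2} \<in> mackey_sets Y"
proof -
  have K: "K1 \<subseteq> Y" "K2 \<subseteq> Y" "absolutely_convex K1" "absolutely_convex K2"
    "compactin weak_star_topology K1" "compactin weak_star_topology K2"
    using assms by (auto simp: mackey_sets_def)
  have eq: "{a + b | a b. a \<in> K1 \<and> b \<in> K2} = (\<lambda>p. fst p + snd p) ` (K1 \<times> K2)" by force
  have "continuous_map (prod_topology weak_star_topology weak_star_topology) weak_star_topology
      (\<lambda>p. fst p + (snd p :: 'a \<Rightarrow>\<^sub>L real))"
  proof (rule continuous_map_into_weak_star)
    fix z :: 'a
    have 1: "continuous_map (prod_topology weak_star_topology weak_star_topology) euclideanreal
       ((\<lambda>y. blinfun_apply y z) \<circ> fst)"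
      by (rule continuous_map_compose[OF continuous_map_fst continuous_map_weak_star_eval])
    have 2: "continuous_map (prod_topology weak_star_topology weak_star_topology) euclideanreal
       ((\<lambda>y. blinfun_apply y z) \<circ> snd)"
      by (rule continuous_map_compose[OF continuous_map_snd continuous_map_weak_star_eval])
    show "continuous_map (prod_topology weak_star_topology weak_star_topology) euclideanreal
       (\<lambda>p. blinfun_apply (fst p + snd p) z)"
      using continuous_map_add[OF 1 2] by (simp add: blinfun.add_left)
  qed
  then have "compactin weak_star_topology {a + b | a b. a \<in> K1 \<and> b \<in> K2}"
    unfolding eq by (rule image_compactin[rotated]) (use K in \<open>simp add: compactin_Times\<close>)
  moreover have "absolutely_convex {a + b | a b. a \<in> K1 \<and> b \<in> K2}"
    unfolding absolutely_convex_def
  proof (intro conjI ballI allI impI)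
    have "{a + b | a b. a \<in> K1 \<and> b \<in> K2} = (\<Union>a\<in>K1. \<Union>b\<in>K2. {a + b})" by blast
    then show "convex {a + b | a b. a \<in> K1 \<and> b \<in> K2}"
      using convex_sums[of K1 K2] K by (simp add: absolutely_convex_def)
    fix y and r :: real assume "y \<in> {a + b | a b. a \<in> K1 \<and> b \<in> K2}" "\<bar>r\<bar> \<le> 1"
    then show "r *\<^sub>R y \<in> {a + b | a b. a \<in> K1 \<and> b \<in> K2}"
      using K unfolding absolutely_convex_def by (auto simp: scaleR_add_right) blast
  qed
  moreover have "{a + b | a b. a \<in> K1 \<and> b \<in> K2} \<subseteq> Y" using K subspace_add[OF Y] by blast
  ultimately show ?thesis by (simp add: mackey_sets_def)
qed

text \<open>Since segments are Mackey sets, Mackey convergence implies pointwise convergence on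
  Y.\<close>

lemma mackey_sets_segment:
  assumes "subspace Y" "y \<in> Y"
  shows "(\<lambda>t. t *\<^sub>R y) ` {-1..1::real} \<in> mackey_sets Y"
proof -
  have "continuous_map euclideanreal weak_star_topology (\<lambda>t. t *\<^sub>R y)"
    by (rule continuous_map_into_weak_star) (auto simp: blinfun.scaleR_left intro!: continuous_intros)
  then have "compactin weak_star_topology ((\<lambda>t. t *\<^sub>R y) ` {-1..1::real})"
    by (rule image_compactin[rotated]) simp
  moreover have "absolutely_convex ((\<lambda>t. t *\<^sub>R y) ` {-1..1::real})"
    unfolding absolutely_convex_def
  proof (intro conjI ballI allI impI)
    show "convex ((\<lambda>t. t *\<^sub>R y) ` {-1..1::real})"
      by (intro convex_linear_image linearI) (auto simp: scaleR_add_left)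
    fix w and a :: real assume "w \<in> (\<lambda>t. t *\<^sub>R y) ` {-1..1}" "\<bar>a\<bar> \<le> 1"
    then obtain t where t: "w = t *\<^sub>R y" "\<bar>t\<bar> \<le> 1" by (force simp: abs_le_iff)
    have "\<bar>a * t\<bar> \<le> 1" using t(2) \<open>\<bar>a\<bar> \<le> 1\<close> by (simp add: abs_mult mult_le_one)
    then show "a *\<^sub>R w \<in> (\<lambda>t. t *\<^sub>R y) ` {-1..1}" using t(1) by (auto simp: abs_le_iff)
  qed
  moreover have "(\<lambda>t. t *\<^sub>R y) ` {-1..1::real} \<subseteq> Y" using assms by (auto intro: subspace_scale)
  ultimately show ?thesis by (simp add: mackey_sets_def)
qed

text \<open>The core of Grothendieck's theorem. With N the seminorm built from F, one has h - e
  \<le> e N on K, and Mazur--Orlicz inserts a linear v between the two. As v \<le> e N, it vanishes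
  on the common kernel of F and is evaluation at some z. Symmetry of K makes the estimate
  two-sided.\<close>

lemma uniform_approx_on_absolutely_convex:
  fixes h :: "('z::real_normed_vector \<Rightarrow>\<^sub>L real) \<Rightarrow> real"
  assumes h: "linear h" and K: "absolutely_convex K" "K \<noteq> {}"
    and F: "finite F" and d: "d > 0" and e: "e > 0"
    and small: "\<And>k. k \<in> K \<Longrightarrow> (\<And>f. f \<in> F \<Longrightarrow> \<bar>blinfun_apply k f\<bar> \<le> d) \<Longrightarrow> \<bar>h k\<bar> \<le> e"
  obtains z where "\<And>k. k \<in> K \<Longrightarrow> \<bar>blinfun_apply k z - h k\<bar> \<le> e"
proof -
  define N :: "('z \<Rightarrow>\<^sub>L real) \<Rightarrow> real" where "N y = (\<Sum>f\<in>F. \<bar>blinfun_apply y f\<bar>) / d" for y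
  have N_nonneg: "N y \<ge> 0" for y using d by (simp add: N_def sum_nonneg)
  have N_scale: "N (c *\<^sub>R y) = \<bar>c\<bar> * N y" for c y
    by (simp add: N_def blinfun.scaleR_left abs_mult flip: sum_distrib_left)
  have N_add: "N (x + y) \<le> N x + N y" for x y
  proof -
    have "(\<Sum>f\<in>F. \<bar>blinfun_apply (x + y) f\<bar>) \<le> (\<Sum>f\<in>F. \<bar>blinfun_apply x f\<bar> + \<bar>blinfun_apply y f\<bar>)"
      by (intro sum_mono) (simp add: blinfun.add_left abs_triangle_ineq)
    then show ?thesis
      using d by (simp add: N_def sum.distrib divide_right_mono flip: add_divide_distrib)
  qed
  have N_F: "\<bar>blinfun_apply y f\<bar> \<le> d * N y" if "f \<in> F" for y f
    using member_le_sum[OF that, of "\<lambda>f. \<bar>blinfun_apply y f\<bar>"] F d by (simp add: N_def)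
  have scale: "c *\<^sub>R k \<in> K" if "k \<in> K" "\<bar>c\<bar> \<le> 1" for c k
    using K that by (auto simp: absolutely_convex_def)
  have sub: "sublinear (\<lambda>y. e * N y)"
  proof (rule sublinearI)
    show "e * N (x + y) \<le> e * N x + e * N y" for x y
      using N_add[of x y] e by (simp flip: distrib_left)
    show "e * N 0 = 0" by (simp add: N_def)
    show "e * N (c *\<^sub>R x) \<le> c * (e * N x)" if "c > 0" for c x using that by (simp add: N_scale)
  qed
  have conc: "concave_on K (\<lambda>k. h k - e)"
    using K h unfolding concave_on_iff absolutely_convex_def
    by (auto simp: linear_add linear_scale algebra_simps simp flip: distrib_right)
  \<comment> \<open>If N(k) \<le> 1, then \<open>small\<close> applies to k itself. If N(k) > 1, it
    applies to k / N(k), which stays in K because K is balanced.\<close>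
  have le: "h k - e \<le> e * N k" if k: "k \<in> K" for k
  proof (cases "N k \<le> 1")
    case True
    have "\<bar>blinfun_apply k f\<bar> \<le> d" if "f \<in> F" for f
      using N_F[OF that, of k] True d mult_left_mono[of "N k" 1 d] by linarith
    with small[OF k] have "h k \<le> e" by (simp add: abs_le_iff)
    moreover have "0 \<le> e * N k" using N_nonneg[of k] e by simp
    ultimately show ?thesis by linarith
  next
    case False
    define w where "w = inverse (N k) *\<^sub>R k"
    have "w \<in> K" using k False by (auto simp: w_def inverse_le_1_iff intro: scale)
    moreover have "N w = 1" using False by (simp add: w_def N_scale)
    ultimately have "\<bar>h w\<bar> \<le> e" using N_F[of _ w] by (intro small) auto
    moreover have "h k = N k * h w" using False by (simp add: w_def linear_scale[OF h])
    ultimately have "h k \<le> N k * e" using False by (simp add: abs_le_iff mult_left_mono)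
    with e show ?thesis by (simp add: mult.commute)
  qed
  obtain v where v: "linear v" "\<And>y. v y \<le> e * N y" "\<And>k. k \<in> K \<Longrightarrow> h k - e \<le> v k"
    using mazur_orlicz[OF sub K(2) conc le] by blast
  have "v y = 0" if y: "\<And>f. f \<in> F \<Longrightarrow> blinfun_apply y f = 0" for y
  proof -
    have "N y = 0" using y by (simp add: N_def)
    moreover have "N (- y) = N y" using N_scale[of "-1" y] by simp
    ultimately show ?thesis using v(2)[of y] v(2)[of "- y"] linear_neg[OF v(1), of y] by simp
  qed
  with F v(1) obtain z where z: "\<And>y. v y = blinfun_apply y z"
    using linear_functional_in_span by blast
  show thesis
  proof (rule that)
    fix k assume k: "k \<in> K"
    have "- k \<in> K" using scale[OF k, of "-1"] by simp
    from v(3)[OF k] v(3)[OF this] show "\<bar>blinfun_apply k z - h k\<bar> \<le> e"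
      unfolding z by (simp add: linear_neg[OF h] blinfun.minus_left abs_le_iff)
  qed
qed

text \<open>Grothendieck's completeness theorem: the points approximating h uniformly on Mackey sets
  generate a Cauchy filter, and its limit represents h on Y.\<close>

lemma mackey_complete_functional:
  fixes h :: "('z::real_normed_vector \<Rightarrow>\<^sub>L real) \<Rightarrow> real"
  assumes Y: "subspace Y" "mackey_complete Y" and h: "linear h"
    and cont: "\<And>K e. K \<in> mackey_sets Y \<Longrightarrow> e > 0 \<Longrightarrow>
      \<exists>F d. finite F \<and> d > 0 \<and> (\<forall>k\<in>K. (\<forall>f\<in>F. \<bar>blinfun_apply k f\<bar> \<le> d) \<longrightarrow> \<bar>h k\<bar> \<le> e)"
  obtains z where "\<And>y. y \<in> Y \<Longrightarrow> blinfun_apply y z = h y"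
proof -
  \<comment> \<open>Requiring 0 in K excludes the empty set and ensures that K1 and K2 lie in their
    sum, which makes the sets \<open>B i\<close> a filter base.\<close>
  define I where "I = {(K, e :: real). K \<in> mackey_sets Y \<and> 0 \<in> K \<and> e > 0}"
  define B where "B = (\<lambda>(K, e). {z. \<forall>k\<in>K. \<bar>blinfun_apply k z - h k\<bar> \<le> e})"
  define \<F> where "\<F> = (INF i\<in>I. principal (B i))"
  have seg: "((\<lambda>t. t *\<^sub>R y) ` {-1..1}, e) \<in> I" if "y \<in> Y" "e > 0" for y e
    using mackey_sets_segment[OF Y(1) that(1)] that(2) by (auto simp: I_def intro!: image_eqI[of _ _ 0])
  have B_ne: "B i \<noteq> {}" if "i \<in> I" for i
  proof -
    obtain K e where i: "i = (K, e)" by fastforce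
    with that have K: "K \<in> mackey_sets Y" "0 \<in> K" "e > 0" by (auto simp: I_def)
    obtain F d where F: "finite F" "d > 0"
      "\<forall>k\<in>K. (\<forall>f\<in>F. \<bar>blinfun_apply k f\<bar> \<le> d) \<longrightarrow> \<bar>h k\<bar> \<le> e"
      using cont[OF K(1) K(3)] by blast
    have "absolutely_convex K" "K \<noteq> {}" using K by (auto simp: mackey_sets_def)
    then obtain z where "\<And>k. k \<in> K \<Longrightarrow> \<bar>blinfun_apply k z - h k\<bar> \<le> e"
      by (rule uniform_approx_on_absolutely_convex[OF h _ _ F(1,2) K(3)]) (use F(3) in auto)
    then show ?thesis by (auto simp: B_def i)
  qed
  have I_ne: "I \<noteq> {}" using seg[OF subspace_0[OF Y(1)], of 1] by auto
  have dir: "\<exists>l\<in>I. principal (B l) \<le> inf (principal (B i)) (principal (B j))" if ij: "i \<in> I" "j \<in> I" for i j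
  proof -
    obtain K1 e1 K2 e2 where i: "i = (K1, e1)" and j: "j = (K2, e2)" by fastforce
    with ij have K: "K1 \<in> mackey_sets Y" "0 \<in> K1" "e1 > 0" "K2 \<in> mackey_sets Y" "0 \<in> K2" "e2 > 0"
      by (auto simp: I_def)
    define L where "L = {a + b | a b. a \<in> K1 \<and> b \<in> K2}"
    have "L \<in> mackey_sets Y" unfolding L_def using Y(1) K by (intro mackey_sets_sum)
    moreover have sub: "K1 \<subseteq> L" "K2 \<subseteq> L" unfolding L_def using K by force+
    ultimately have "(L, min e1 e2) \<in> I" using K by (auto simp: I_def)
    moreover have "B (L, min e1 e2) \<subseteq> B i \<inter> B j" unfolding B_def i j using sub by auto
    ultimately show ?thesis by (intro bexI) auto
  qed
  have ev: "eventually P \<F> \<longleftrightarrow> (\<exists>i\<in>I. \<forall>z\<in>B i. P z)" for P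
    unfolding \<F>_def
    by (subst eventually_INF_base[where F = "\<lambda>i. principal (B i)", OF I_ne dir])
      (simp_all add: eventually_principal)
  have "\<F> \<noteq> bot"
    using B_ne unfolding trivial_limit_def[of \<F>] ev by blast
  have "mackey_cauchy Y \<F>"
    unfolding mackey_cauchy_def
  proof (intro ballI allI impI)
    fix K and e :: real assume K: "K \<in> mackey_sets Y" and e: "e > 0"
    show "\<forall>\<^sub>F (a, b) in \<F> \<times>\<^sub>F \<F>. \<forall>y\<in>K. \<bar>blinfun_apply y a - blinfun_apply y b\<bar> \<le> e"
    proof (cases "K = {}")
      case False
      then obtain k where "k \<in> K" by blast
      then have "0 *\<^sub>R k \<in> K" using K unfolding mackey_sets_def absolutely_convex_def mem_Collect_eq
        by (metis abs_zero zero_le_one)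
      then have i: "(K, e / 2) \<in> I" using K e by (auto simp: I_def)
      then have "eventually (\<lambda>z. z \<in> B (K, e / 2)) \<F>" unfolding ev by blast
      moreover have "\<bar>blinfun_apply y a - blinfun_apply y b\<bar> \<le> e"
        if "a \<in> B (K, e / 2)" "b \<in> B (K, e / 2)" "y \<in> K" for a b y
      proof -
        have "\<bar>blinfun_apply y a - h y\<bar> \<le> e / 2" "\<bar>blinfun_apply y b - h y\<bar> \<le> e / 2"
          using that by (auto simp: B_def)
        then show ?thesis by linarith
      qed
      ultimately show ?thesis
        unfolding eventually_prod_filter by (intro exI[of _ "\<lambda>z. z \<in> B (K, e / 2)"]) auto
    qed (simp add: case_prod_unfold)
  qed
  with Y(2) \<open>\<F> \<noteq> bot\<close> obtain z where z: "mackey_converges Y \<F> z" unfolding mackey_complete_def by blast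
  show thesis
  proof (rule that)
    fix y assume y: "y \<in> Y"
    have "\<bar>blinfun_apply y z - h y\<bar> \<le> e" if e: "e > 0" for e
    proof -
      \<comment> \<open>On the segment through y the filter is eventually within e/2 of its limit
        and within e/2 of h; one common point a compares the two at y.\<close>
      define S where "S = (\<lambda>t. t *\<^sub>R y) ` {-1..1::real}"
      have S: "S \<in> mackey_sets Y" "(S, e / 2) \<in> I" "y \<in> S"
        using mackey_sets_segment[OF Y(1) y] seg[OF y] e by (auto simp: S_def intro!: image_eqI[of _ _ 1])
      have "\<forall>\<^sub>F a in \<F>. \<forall>y\<in>S. \<bar>blinfun_apply y a - blinfun_apply y z\<bar> \<le> e / 2"
        using z[unfolded mackey_converges_def, rule_format, OF S(1), of "e / 2"] e by simp
      moreover have "\<forall>\<^sub>F a in \<F>. a \<in> B (S, e / 2)" unfolding ev using S(2) by blast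
      ultimately have "\<forall>\<^sub>F a in \<F>. \<bar>blinfun_apply y a - blinfun_apply y z\<bar> \<le> e / 2 \<and> \<bar>blinfun_apply y a - h y\<bar> \<le> e / 2"
        by eventually_elim (use S(3) in \<open>auto simp: B_def\<close>)
      then obtain a where "\<bar>blinfun_apply y a - blinfun_apply y z\<bar> \<le> e / 2" "\<bar>blinfun_apply y a - h y\<bar> \<le> e / 2"
        using eventually_happens'[OF \<open>\<F> \<noteq> bot\<close>] by blast
      then show ?thesis by linarith
    qed
    then have "\<bar>blinfun_apply y z - h y\<bar> \<le> 0" by (rule field_le_epsilon) simp
    then show "blinfun_apply y z = h y" by simp
  qed
qed

section \<open>Whitley sequences\<close>

text \<open>The supremum defining the norm need not be attained; the factor 2 leaves the room needed
  to pick a point.\<close>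

lemma half_norming:
  fixes y :: "'z::real_normed_vector \<Rightarrow>\<^sub>L real"
  shows "\<exists>f. norm f \<le> 1 \<and> norm y \<le> 2 * \<bar>blinfun_apply y f\<bar>"
proof (rule ccontr)
  assume "\<nexists>f. norm f \<le> 1 \<and> norm y \<le> 2 * \<bar>blinfun_apply y f\<bar>"
  then have *: "2 * \<bar>blinfun_apply y f\<bar> < norm y" if "norm f \<le> 1" for f using that by force
  have "norm y \<le> norm y / 2"
  proof (rule norm_blinfun_bound)
    fix f show "norm (blinfun_apply y f) \<le> norm y / 2 * norm f"
    proof (cases "f = 0")
      case False
      have "2 * \<bar>blinfun_apply y (inverse (norm f) *\<^sub>R f)\<bar> < norm y" using False by (intro *) simp
      with False show ?thesis by (simp add: blinfun.scaleR_right abs_mult field_simps)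
    qed simp
  qed simp
  with *[of 0] show False by simp
qed

text \<open>Rational scalars are countable, so such a set can be exhausted in stages; density of the
  rationals recovers real scalars in the closure.\<close>

lemma subspace_closure_rational:
  fixes A :: "'v::real_normed_vector set"
  assumes ne: "A \<noteq> {}" and add: "\<And>a b. a \<in> A \<Longrightarrow> b \<in> A \<Longrightarrow> a + b \<in> A"
    and scale: "\<And>r a. r \<in> \<rat> \<Longrightarrow> a \<in> A \<Longrightarrow> r *\<^sub>R a \<in> A"
  shows "subspace (closure A)"
proof (rule subspaceI)
  obtain a where "a \<in> A" using ne by blast
  from scale[OF Rats_0 this] show "0 \<in> closure A" using closure_subset by auto
  show "x + y \<in> closure A" if "x \<in> closure A" "y \<in> closure A" for x y
  proof -
    obtain a b where "\<And>n. a n \<in> A" "a \<longlonglongrightarrow> x" "\<And>n. b n \<in> A" "b \<longlonglongrightarrow> y"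
      using \<open>x \<in> _\<close> \<open>y \<in> _\<close> unfolding closure_sequential by blast
    then show ?thesis unfolding closure_sequential
      by (intro exI[of _ "\<lambda>n. a n + b n"]) (auto intro: add tendsto_add)
  qed
  show "c *\<^sub>R x \<in> closure A" if x: "x \<in> closure A" for c x
  proof -
    obtain a where a: "\<And>n. a n \<in> A" "a \<longlonglongrightarrow> x" using x unfolding closure_sequential by blast
    have "c \<in> closure \<rat>" by (simp add: Rats_closure_real)
    then obtain r :: "nat \<Rightarrow> real" where "\<And>n. r n \<in> \<rat>" "r \<longlonglongrightarrow> c" unfolding closure_sequential by blast
    with a show ?thesis unfolding closure_sequential
      by (intro exI[of _ "\<lambda>n. r n *\<^sub>R a n"]) (auto intro: scale tendsto_scaleR)
  qed
qed

text \<open>Finite sets A(n) grow while k(n) is chosen small at the half-norming points of A(n).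
  Their union U is closed under sums and rational multiples, so M is its closure and G the set of
  half-norming points of U. Each point of G is controlled from some stage on, whence convergence to
  0.\<close>

lemma whitley_sequence:
  fixes \<phi> :: "'z::real_normed_vector \<Rightarrow>\<^sub>L real"
  assumes small: "\<And>F d. finite F \<Longrightarrow> d > 0 \<Longrightarrow> \<exists>k\<in>C. \<forall>f\<in>F. \<bar>blinfun_apply k f\<bar> \<le> d"
  obtains k M G where "\<And>n. k n \<in> C" "subspace M" "closed M" "\<phi> \<in> M" "\<And>n. k n \<in> M"
    "\<And>z. z \<in> M \<Longrightarrow> (\<And>f. f \<in> G \<Longrightarrow> blinfun_apply z f = 0) \<Longrightarrow> z = 0"
    "\<And>f. f \<in> G \<Longrightarrow> (\<lambda>n. blinfun_apply (k n) f) \<longlonglongrightarrow> 0"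
proof -
  obtain g where g: "\<And>y :: 'z \<Rightarrow>\<^sub>L real. norm (g y) \<le> 1" "\<And>y :: 'z \<Rightarrow>\<^sub>L real. norm y \<le> 2 * \<bar>blinfun_apply y (g y)\<bar>"
    using half_norming by metis
  define q :: "nat \<Rightarrow> real" where "q = from_nat_into \<rat>"
  have q: "range q = \<rat>"
    unfolding q_def using countable_rat Rats_0 by (intro range_from_nat_into) blast+
  \<comment> \<open>Only the first n + 1 rationals act at stage n, which keeps each stage finite;
    every rational multiple still appears at a later stage.\<close>
  define ext where "ext n A k = A \<union> {k} \<union> (\<lambda>(a, b). a + b) ` (A \<times> A) \<union> (\<lambda>(i, a). q i *\<^sub>R a) ` ({..n} \<times> A)"
    for n :: nat and A :: "('z \<Rightarrow>\<^sub>L real) set" and k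
  define R where "R = (\<lambda>n (A, k). finite A \<and> \<phi> \<in> A \<and> k \<in> C \<and>
    (\<forall>y\<in>A. \<bar>blinfun_apply k (g y)\<bar> \<le> inverse (real (Suc n))))"
  have step: "\<exists>k. R n (A, k)" if "finite A" "\<phi> \<in> A" for n A
    using small[of "g ` A" "inverse (real (Suc n))"] that by (auto simp: R_def)
  have "\<exists>s. \<forall>n. R n (s n) \<and> fst (s (Suc n)) = ext n (fst (s n)) (snd (s n))"
  proof (rule dependent_nat_choice)
    show "\<exists>s. R 0 s" using step[of "{\<phi>}" 0] by blast
    fix s n assume "R n s"
    then have "finite (ext n (fst s) (snd s))" "\<phi> \<in> ext n (fst s) (snd s)"
      by (auto simp: R_def ext_def split: prod.splits)
    from step[OF this] show "\<exists>s'. R (Suc n) s' \<and> fst s' = ext n (fst s) (snd s)" by force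
  qed
  then obtain s where s: "\<And>n. R n (s n)" "\<And>n. fst (s (Suc n)) = ext n (fst (s n)) (snd (s n))" by blast
  define A k where "A n = fst (s n)" and "k n = snd (s n)" for n
  have A_Suc: "A (Suc n) = ext n (A n) (k n)" for n using s(2) by (simp add: A_def k_def)
  have R: "\<phi> \<in> A n" "k n \<in> C" "\<And>y. y \<in> A n \<Longrightarrow> \<bar>blinfun_apply (k n) (g y)\<bar> \<le> inverse (real (Suc n))" for n
    using s(1)[of n] by (auto simp: R_def A_def k_def split: prod.splits)
  have mono: "A m \<subseteq> A n" if "m \<le> n" for m n
    using that by (rule lift_Suc_mono_le[rotated]) (auto simp: A_Suc ext_def)
  define U where "U = (\<Union>n. A n)"
  have kU: "k n \<in> U" for n
  proof -
    have "k n \<in> A (Suc n)" by (simp add: A_Suc ext_def)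
    then show ?thesis unfolding U_def by blast
  qed
  have "subspace (closure U)"
  proof (rule subspace_closure_rational)
    show "U \<noteq> {}" using kU by blast
    show "a + b \<in> U" if ab: "a \<in> U" "b \<in> U" for a b
    proof -
      obtain m n where "a \<in> A m" "b \<in> A n" using ab by (auto simp: U_def)
      then have "a \<in> A (max m n)" "b \<in> A (max m n)" using mono[of m "max m n"] mono[of n "max m n"] by auto
      then have "a + b \<in> A (Suc (max m n))" unfolding A_Suc ext_def by force
      then show ?thesis unfolding U_def by blast
    qed
    show "r *\<^sub>R a \<in> U" if ra: "r \<in> \<rat>" "a \<in> U" for r a
    proof -
      obtain i where "r = q i" using ra(1) unfolding q[symmetric] by blast
      obtain m where "a \<in> A m" using ra(2) by (auto simp: U_def)
      then have "a \<in> A (max m i)" using mono[of m "max m i"] by auto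
      then have "r *\<^sub>R a \<in> A (Suc (max m i))" unfolding A_Suc ext_def \<open>r = q i\<close> by force
      then show ?thesis unfolding U_def by blast
    qed
  qed
  moreover have "z = 0" if z: "z \<in> closure U" and zero: "\<And>f. f \<in> g ` U \<Longrightarrow> blinfun_apply z f = 0" for z
  proof -
    \<comment> \<open>Pick a in U within e/3 of z. As z vanishes at g(a), half-norming bounds
      \<open>norm a\<close> by twice \<open>norm (a - z)\<close>, and the triangle inequality uses
      up the third e/3.\<close>
    have "norm z \<le> e" if e: "e > 0" for e
    proof -
      obtain a where a: "a \<in> U" "norm (a - z) < e / 3"
        using z[unfolded closure_approachable, THEN spec, of "e / 3"] e by (auto simp: dist_norm)
      have "norm a \<le> 2 * \<bar>blinfun_apply (a - z) (g a)\<bar>"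
        using g(2)[of a] zero[of "g a"] a(1) by (simp add: blinfun.diff_left)
      also have "\<bar>blinfun_apply (a - z) (g a)\<bar> \<le> norm (a - z) * norm (g a)"
        using norm_blinfun[of "a - z" "g a"] by simp
      also have "\<dots> \<le> norm (a - z)" using g(1)[of a] by (simp add: mult_left_le)
      finally have "norm a \<le> 2 * norm (a - z)" by simp
      then show ?thesis using a(2) norm_triangle_sub[of z a] by (simp add: norm_minus_commute)
    qed
    then have "norm z \<le> 0" by (rule field_le_epsilon) simp
    then show ?thesis by simp
  qed
  moreover have "(\<lambda>n. blinfun_apply (k n) f) \<longlonglongrightarrow> 0" if fU: "f \<in> g ` U" for f
  proof -
    obtain y m where f: "f = g y" "y \<in> A m" using fU by (auto simp: U_def)
    have "\<forall>\<^sub>F n in sequentially. norm (blinfun_apply (k n) f) \<le> inverse (real (Suc n))"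
      unfolding eventually_sequentially
    proof (intro exI allI impI)
      fix n assume "m \<le> n"
      then have "y \<in> A n" using mono f(2) by blast
      from R(3)[OF this] show "norm (blinfun_apply (k n) f) \<le> inverse (real (Suc n))" by (simp add: f(1))
    qed
    then show ?thesis by (rule Lim_null_comparison[OF _ LIMSEQ_inverse_real_of_nat])
  qed
  moreover have "\<phi> \<in> closure U" using R(1)[of 0] closure_subset[of U] by (auto simp: U_def)
  moreover have "k n \<in> closure U" for n using kU closure_subset by blast
  ultimately show thesis using R(2) by (intro that[of k "closure U" "g ` U"]) auto
qed

section \<open>Weak-star sequential density\<close>

theorem theorem4p5:
  assumes "fully_mackey_complete TYPE('a::banach \<Rightarrow>\<^sub>L real)"
  shows "\<forall>\<phi> :: ('a \<Rightarrow>\<^sub>L real) \<Rightarrow>\<^sub>L real. \<exists>x :: nat \<Rightarrow> 'a.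
           \<forall>f :: 'a \<Rightarrow>\<^sub>L real. (\<lambda>n. blinfun_apply f (x n)) \<longlonglongrightarrow> blinfun_apply \<phi> f"
proof
  fix \<phi> :: "('a \<Rightarrow>\<^sub>L real) \<Rightarrow>\<^sub>L real"
  show "\<exists>x :: nat \<Rightarrow> 'a. \<forall>f. (\<lambda>n. blinfun_apply f (x n)) \<longlonglongrightarrow> blinfun_apply \<phi> f"
  proof (cases "\<phi> \<in> range ev")
    case True
    then obtain x where "\<phi> = ev x" by blast
    then show ?thesis by (intro exI[of _ "\<lambda>_. x"]) simp
  next
    case False
    then obtain h :: "(('a \<Rightarrow>\<^sub>L real) \<Rightarrow>\<^sub>L real) \<Rightarrow>\<^sub>L real"
      where h: "\<And>y. y \<in> range ev \<Longrightarrow> blinfun_apply h y = 0" and h1: "blinfun_apply h \<phi> = 1"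
      using hahn_banach_closed_subspace[OF subspace_range_ev closed_range_ev False] by metis
    have h0: "blinfun_apply h (ev x) = 0" for x by (rule h) simp
    \<comment> \<open>On X + \<real>\<phi> this is the projection onto X along \<phi>. Writing E as
      a preimage under the bounded map p gives closedness at once.\<close>
    define p where "p y = y - blinfun_apply h y *\<^sub>R \<phi>" for y
    have p: "bounded_linear p"
      unfolding p_def
      by (intro bounded_linear_sub bounded_linear_ident bounded_linear_scaleR_const blinfun.bounded_linear_right)
    define E where "E = p -` range ev"
    have E: "subspace E"
      unfolding E_def using linear_subspace_vimage[OF bounded_linear.linear[OF p] subspace_range_ev] .
    have "closed E" unfolding E_def
      using closed_range_ev linear_continuous_on[OF p] by (intro closed_vimage) (auto simp: continuous_on_eq_continuous_at)
    have evE: "ev x \<in> E" for x by (simp add: E_def p_def h0)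
    have \<phi>E: "\<phi> \<in> E" using linear_0[OF linear_ev] by (auto simp: E_def p_def h1 intro: range_eqI[of _ _ 0])
    have "norming E"
      unfolding norming_def
    \<comment> \<open>The constant 1 works because the unit ball of X, contained in E, already norms
      X*.\<close>
    proof (intro exI[of _ 1] conjI allI)
      fix f :: "'a \<Rightarrow>\<^sub>L real"
      have bdd: "bdd_above {blinfun_apply y f | y. y \<in> E \<and> norm y \<le> 1}"
      proof (rule bdd_aboveI)
        fix r assume "r \<in> {blinfun_apply y f | y. y \<in> E \<and> norm y \<le> 1}"
        then obtain y where y: "r = blinfun_apply y f" "norm y \<le> 1" by blast
        have "r \<le> norm y * norm f" using norm_blinfun[of y f] y(1) by simp
        also have "\<dots> \<le> norm f" using y(2) by (simp add: mult_left_le_one_le)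
        finally show "r \<le> norm f" .
      qed
      have le: "\<bar>blinfun_apply f x\<bar> \<le> Sup {blinfun_apply y f | y. y \<in> E \<and> norm y \<le> 1}" if "norm x \<le> 1" for x
      proof -
        have "blinfun_apply (ev w) f \<le> Sup {blinfun_apply y f | y. y \<in> E \<and> norm y \<le> 1}" if "norm w \<le> 1" for w
          using that evE by (intro cSup_upper[OF _ bdd]) (auto intro!: exI[of _ "ev w"])
        from this[of x] this[of "- x"] that show ?thesis by (simp add: blinfun.minus_right abs_le_iff)
      qed
      have "norm f \<le> Sup {blinfun_apply y f | y. y \<in> E \<and> norm y \<le> 1}"
      proof (rule norm_blinfun_bound)
        show "0 \<le> Sup {blinfun_apply y f | y. y \<in> E \<and> norm y \<le> 1}" using le[of 0] by simp
        fix x show "norm (blinfun_apply f x) \<le> Sup {blinfun_apply y f | y. y \<in> E \<and> norm y \<le> 1} * norm x"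
        proof (cases "x = 0")
          case False
          then show ?thesis using le[of "inverse (norm x) *\<^sub>R x"]
            by (simp add: blinfun.scaleR_right abs_mult field_simps)
        qed simp
      qed
      then show "1 * norm f \<le> Sup {blinfun_apply y f | y. y \<in> E \<and> norm y \<le> 1}" by simp
    qed simp
    with assms E \<open>closed E\<close> have complete: "mackey_complete E" unfolding fully_mackey_complete_def by blast
    \<comment> \<open>Were h weak-star continuous at 0 on every Mackey set, it would be evaluation
      at some z in X*. Vanishing on X forces z = 0, against h(\<phi>) = 1.\<close>
    have "\<not> (\<forall>K\<in>mackey_sets E. \<forall>e>0.
      \<exists>F d. finite F \<and> d > 0 \<and> (\<forall>k\<in>K. (\<forall>f\<in>F. \<bar>blinfun_apply k f\<bar> \<le> d) \<longrightarrow> \<bar>blinfun_apply h k\<bar> \<le> e))"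
    proof
      assume cont: "\<forall>K\<in>mackey_sets E. \<forall>e>0.
        \<exists>F d. finite F \<and> d > 0 \<and> (\<forall>k\<in>K. (\<forall>f\<in>F. \<bar>blinfun_apply k f\<bar> \<le> d) \<longrightarrow> \<bar>blinfun_apply h k\<bar> \<le> e)"
      have "linear (blinfun_apply h)" using blinfun.bounded_linear_right bounded_linear.linear by blast
      from mackey_complete_functional[OF E complete this] cont
      obtain z where z: "\<And>y. y \<in> E \<Longrightarrow> blinfun_apply y z = blinfun_apply h y" by blast
      have "z = 0" using z[OF evE] h0 by (intro blinfun_eqI) simp
      with z[OF \<phi>E] h1 show False by simp
    qed
    then obtain K e where K: "K \<in> mackey_sets E" and e: "e > 0"
      and K': "\<And>F d. finite F \<Longrightarrow> d > 0 \<Longrightarrow>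
        \<exists>k\<in>K. (\<forall>f\<in>F. \<bar>blinfun_apply k f\<bar> \<le> d) \<and> \<bar>blinfun_apply h k\<bar> > e"
      by (meson not_le)
    have KE: "K \<subseteq> E" and Kc: "compactin weak_star_topology K" and
      Ks: "\<And>k c. k \<in> K \<Longrightarrow> \<bar>c\<bar> \<le> 1 \<Longrightarrow> c *\<^sub>R k \<in> K"
      using K by (auto simp: mackey_sets_def absolutely_convex_def)
    \<comment> \<open>Scaling by e / h(k), of modulus at most 1, turns
      \<open>\<bar>h k\<bar> > e\<close> into equality without leaving K or enlarging the values on
      F. Thus all members of C have the same \<phi>-coefficient e.\<close>
    define C where "C = {k \<in> K. blinfun_apply h k = e}"
    have "\<exists>k\<in>C. \<forall>f\<in>F. \<bar>blinfun_apply k f\<bar> \<le> d" if Fd: "finite F" "d > 0" for F d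
    proof -
      obtain k where k: "k \<in> K" "\<And>f. f \<in> F \<Longrightarrow> \<bar>blinfun_apply k f\<bar> \<le> d" "\<bar>blinfun_apply h k\<bar> > e"
        using K'[OF Fd] by blast
      define c where "c = e / blinfun_apply h k"
      have c: "\<bar>c\<bar> \<le> 1" using k(3) e by (simp add: c_def)
      have "blinfun_apply h (c *\<^sub>R k) = e" using k(3) e by (auto simp: c_def blinfun.scaleR_right)
      with k(1) c have "c *\<^sub>R k \<in> C" by (simp add: C_def Ks)
      moreover have "\<bar>blinfun_apply (c *\<^sub>R k) f\<bar> \<le> d" if "f \<in> F" for f
      proof -
        have "\<bar>blinfun_apply (c *\<^sub>R k) f\<bar> = \<bar>c\<bar> * \<bar>blinfun_apply k f\<bar>" by (simp add: blinfun.scaleR_left abs_mult)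
        also have "\<dots> \<le> \<bar>blinfun_apply k f\<bar>" using c by (simp add: mult_left_le_one_le)
        finally show ?thesis using k(2)[OF that] by linarith
      qed
      ultimately show ?thesis by blast
    qed
    from whitley_sequence[of C \<phi>, OF this]
    obtain k M G where kC: "\<And>n. k n \<in> C" and M: "subspace M" "closed M" "\<phi> \<in> M" "\<And>n. k n \<in> M"
      and sep: "\<And>z. z \<in> M \<Longrightarrow> (\<And>f. f \<in> G \<Longrightarrow> blinfun_apply z f = 0) \<Longrightarrow> z = 0"
      and G: "\<And>f. f \<in> G \<Longrightarrow> (\<lambda>n. blinfun_apply (k n) f) \<longlonglongrightarrow> 0"
      by blast
    have kK: "k n \<in> K" and hk: "blinfun_apply h (k n) = e" for n using kC by (auto simp: C_def)
    have "\<exists>x. k n = ev x + e *\<^sub>R \<phi>" for n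
    proof -
      have "p (k n) \<in> range ev" using kK KE by (auto simp: E_def)
      then show ?thesis by (auto simp: p_def hk algebra_simps)
    qed
    then obtain x where x: "\<And>n. k n = ev (x n) + e *\<^sub>R \<phi>" by metis
    \<comment> \<open>The condition on a and b says that z = a (u - e\<phi>) + b (v - e\<phi>) has
      no \<phi>-component, so z lies in X. Once z, and with it w, is known to lie in M, the family G
      separates w from nothing but 0, since all cluster points vanish on G.\<close>
    have key: "a *\<^sub>R u + b *\<^sub>R v = 0"
      if uv: "u \<in> K" "v \<in> K" "weak_star_cluster k UNIV u" "weak_star_cluster k UNIV v"
        and ab: "a * (blinfun_apply h u - e) + b * (blinfun_apply h v - e) = 0" for a b u v
    proof -
      define w where "w = a *\<^sub>R u + b *\<^sub>R v"
      define z where "z = w - ((a + b) * e) *\<^sub>R \<phi>"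
      have "z \<in> E" unfolding z_def w_def using uv KE \<phi>E E
        by (intro subspace_diff subspace_add subspace_scale) auto
      moreover have "blinfun_apply h z = 0"
        using ab by (simp add: z_def w_def blinfun.bilinear_simps h1 algebra_simps)
      ultimately obtain y where y: "z = ev y" by (auto simp: E_def p_def)
      have "ev y \<in> M"
      proof (rule ccontr)
        assume "ev y \<notin> M"
        have "subspace (ev -` M)" using linear_subspace_vimage[OF linear_ev M(1)] .
        moreover have "closed (ev -` M)"
          using M(2) linear_continuous_on[OF bounded_linear_ev] by (intro closed_vimage) auto
        \<comment> \<open>Separation takes place in X, so f is in X* and weak-star cluster points
          can be tested on it. All x(n) lie in the preimage of M, hence k(n)(f) is constantly e
          \<phi>(f), and so are u(f) and v(f).\<close>
        ultimately obtain f :: "'a \<Rightarrow>\<^sub>L real" where f: "\<And>s. ev s \<in> M \<Longrightarrow> blinfun_apply f s = 0" "blinfun_apply f y = 1"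
          using hahn_banach_closed_subspace[of "ev -` M" y] \<open>ev y \<notin> M\<close> by auto
        have "ev (x n) \<in> M" for n
        proof -
          have "k n - e *\<^sub>R \<phi> \<in> M" using M by (intro subspace_diff subspace_scale)
          then show ?thesis by (simp add: x)
        qed
        then have "blinfun_apply (k n) f = e * blinfun_apply \<phi> f" for n
          using f(1) by (simp add: x blinfun.bilinear_simps)
        then have "(\<lambda>n. blinfun_apply (k n) f) \<longlonglongrightarrow> e * blinfun_apply \<phi> f" by simp
        then have "blinfun_apply u f = e * blinfun_apply \<phi> f" "blinfun_apply v f = e * blinfun_apply \<phi> f"
          using weak_star_cluster_eval uv by blast+
        then have "blinfun_apply z f = 0" by (simp add: z_def w_def blinfun.bilinear_simps algebra_simps)
        with f(2) y show False by simp
      qed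
      then have "z + ((a + b) * e) *\<^sub>R \<phi> \<in> M" using M y by (intro subspace_add subspace_scale) auto
      then have "w \<in> M" by (simp add: z_def)
      moreover have "blinfun_apply w f = 0" if "f \<in> G" for f
        using weak_star_cluster_eval[OF uv(3) G[OF that]] weak_star_cluster_eval[OF uv(4) G[OF that]]
        by (simp add: w_def blinfun.bilinear_simps)
      ultimately show ?thesis unfolding w_def by (rule sep)
    qed
    have ne: "blinfun_apply h u \<noteq> e" if "u \<in> K" "weak_star_cluster k UNIV u" for u
    proof
      assume "blinfun_apply h u = e"
      \<comment> \<open>If h(u) = e, the single vector u already satisfies the condition in
        \<open>key\<close>.\<close>
      with key[OF that(1,1,2,2), of 1 0] have "u = 0" by simp
      with \<open>blinfun_apply h u = e\<close> e show False by simp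
    qed
    obtain u where u: "u \<in> K" "weak_star_cluster k UNIV u" using weak_star_cluster_exists[of K k UNIV, OF Kc kK] by auto
    have uniq: "v = u" if v: "v \<in> K" "weak_star_cluster k UNIV v" for v
    proof -
      define s t where "s = blinfun_apply h u - e" and "t = blinfun_apply h v - e"
      \<comment> \<open>The coefficients t and -s cancel the deviations s and t from e. Applying h
        to the resulting relation leaves e (t - s) = 0, so t = s, which is nonzero, and u =
        v.\<close>
      have 0: "t *\<^sub>R u + (- s) *\<^sub>R v = 0" by (rule key[OF u(1) v(1) u(2) v(2)]) (simp add: s_def t_def algebra_simps)
      have "t * blinfun_apply h u - s * blinfun_apply h v = 0"
        using arg_cong[OF 0, of "blinfun_apply h"] by (simp add: blinfun.bilinear_simps)
      then have "e * (t - s) = 0" by (simp add: s_def t_def algebra_simps)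
      then have "t = s" using e by simp
      moreover have "s \<noteq> 0" using ne[OF u] by (simp add: s_def)
      ultimately show ?thesis using 0 by (simp flip: scaleR_diff_right)
    qed
    have lim: "(\<lambda>n. blinfun_apply (k n) f) \<longlonglongrightarrow> blinfun_apply u f" for f
      by (rule unique_weak_star_cluster_tendsto[OF Kc kK uniq])
    define c where "c = blinfun_apply h u"
    have "c \<noteq> e" using ne[OF u] by (simp add: c_def)
    have "p u \<in> range ev" using u(1) KE by (auto simp: E_def)
    then obtain x' where u_eq: "u = ev x' + c *\<^sub>R \<phi>" by (auto simp: p_def c_def algebra_simps)
    \<comment> \<open>Since x(n) = k(n) - e\<phi> tends weak-star to u - e\<phi> = x' + (c -
      e)\<phi>, subtracting x' and dividing by c - e gives \<phi>.\<close>
    have "(\<lambda>n. blinfun_apply f (inverse (c - e) *\<^sub>R (x n - x'))) \<longlonglongrightarrow> blinfun_apply \<phi> f" for f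
    proof -
      have "(\<lambda>n. inverse (c - e) * (blinfun_apply (k n) f - e * blinfun_apply \<phi> f - blinfun_apply f x')) \<longlonglongrightarrow>
          inverse (c - e) * (blinfun_apply u f - e * blinfun_apply \<phi> f - blinfun_apply f x')"
        by (intro tendsto_intros lim)
      also have "inverse (c - e) * (blinfun_apply u f - e * blinfun_apply \<phi> f - blinfun_apply f x') = blinfun_apply \<phi> f"
        using \<open>c \<noteq> e\<close> by (simp add: u_eq blinfun.bilinear_simps flip: left_diff_distrib)
      finally show ?thesis by (simp add: x blinfun.bilinear_simps algebra_simps)
    qed
    then show ?thesis by (intro exI[of _ "\<lambda>n. inverse (c - e) *\<^sub>R (x n - x')"] allI)
  qed
qed

end
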